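(* Let $\mu\in\mathbb{Z}_{\ge0}^n$. For $(i,j)\in dg(\mu)$ (i.e. $i\in\{1,\dots,n\}$ and $j\in\{1,\dots,\mu_i\}$) define $$u_\mu(i,j)=\#\{i'\in\{1,\dots,i-1\}\mid \mu_{i'}<j\le\mu_i\}+\#\{i'\in\{i+1,\dots,n\}\mid\mu_{i'}<j-1<\mu_i\},$$ $$R_\mu(i,j)=\{\varepsilon^\vee_{v_\mu(i)}-\varepsilon^\vee_1+(\mu_i-j+1)K,\ \dots,\ \varepsilon^\vee_{v_\mu(i)}-\varepsilon^\vee_{u_\mu(i,j)}+(\mu_i-j+1)K\}$$ (so $R_\mu(i,j)=\emptyset$ if $u_\mu(i,j)=0$). Then: (a) The box-greedy reduced word for $u_\mu$ is $$u_\mu^\square=\prod_{(i,j)\in dg(\mu)}(s_{u_\mu(i,j)}\cdots s_1\pi),$$ where the product is over the boxes of $\mu$ taken from left to right in increasing order of $i+nj$ (and the factor is just $\pi$ if $u_\mu(i,j)=0$). (b) The inversion set and the length of $u_\mu$ are $$\mathrm{Inv}(u_\mu)=\bigcup_{(i,j)\in dg(\mu)}R_\mu(i,j)\qquad\text{and}\qquad \ell(u_\mu)=\sum_{(i,j)\in dg(\mu)}u_\mu(i,j).$$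
   Context: Fix $n\in\mathbb{Z}_{>0}$. $W$ is the group of bijections $w:\mathbb{Z}\to\mathbb{Z}$ with $w(i+n)=w(i)+n$ for all $i$; it contains $S_n$ (extended periodically), with simple transpositions $s_1,\dots,s_{n-1}$, and the element $\pi$ with $\pi(i)=i+1$. $W$ acts on $\mathbb{Z}^n$ by $\pi(\mu_1,\dots,\mu_n)=(\mu_n+1,\mu_1,\dots,\mu_{n-1})$ and with $s_i$ swapping the $i$th and $(i+1)$st entries. For $w\in W$, $\mathrm{Inv}(w)=\{(j,k)\mid j\in\{1,\dots,n\},\ k\in\mathbb{Z},\ j<k,\ w(j)>w(k)\}$ and $\ell(w)=\#\mathrm{Inv}(w)$. The pair $(i,k)=(i,j+mn)$ with $i,j\in\{1,\dots,n\}$, $m\in\mathbb{Z}$, is identified with the affine coroot $\varepsilon_i^\vee-\varepsilon_j^\vee+mK$, an element of the free abelian group with basis $\varepsilon_1^\vee,\dots,\varepsilon_n^\vee,K$. A reduced word for $w$ is an expression of $w$ as a product of letters in $\{s_1,\dots,s_{n-1},\pi\}$ with exactly $\ell(w)$ letters different from $\pi$. For $\mu\in\mathbb{Z}^n_{\ge0}$, $dg(\mu)=\{(i,j)\mid 1\le i\le n,\ 1\le j\le\mu_i\}$; $u_\mu$ is the minimal length element of $W$ with $u_\mu(0,\dots,0)=\mu$; and $v_\mu\in S_n$ is defined by $u_\mu=t_\mu v_\mu^{-1}$, where $t_\mu\in W$ is given by $t_\mu(i)=i+n\mu_i$ for $1\le i\le n$. The box-greedy reduced word $u_\mu^\square$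 for $u_\mu$ is the word in $s_1,\dots,s_{n-1},\pi$, representing $u_\mu$, defined inductively by: $u^\square_{(0,\dots,0)}$ is the empty word, and if $\mu=(0,\dots,0,\mu_k,\mu_{k+1},\dots,\mu_n)$ with $\mu_1=\cdots=\mu_{k-1}=0$ and $\mu_k\neq0$, then $$u^\square_{\mu}=s_{k-1}\cdots s_2s_1\pi\ u^\square_{(0,\dots,0,\mu_{k+1},\dots,\mu_n,\mu_k-1)},$$ where the composition on the right begins with $k-1$ zeros. *)

theory Defs
  imports "HOL-Library.Poly_Mapping"
begin

section \<open>The group of affine permutations\<close>

definition affine_perms :: "nat \<Rightarrow> (int \<Rightarrow> int) set" where
  "affine_perms n = {w. bij w \<and> (\<forall>i. w (i + int n) = w i + int n)}"

definition finite_perms :: "nat \<Rightarrow> (int \<Rightarrow> int) set" where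
  "finite_perms n = {w \<in> affine_perms n. w ` {1..int n} = {1..int n}}"

definition aff_pi :: "int \<Rightarrow> int" where
  "aff_pi i = i + 1"

text \<open>The transposition of \<open>i\<close> and \<open>i + 1\<close>, extended \<open>n\<close>-periodically; meant for \<open>1 \<le> i \<le> n - 1\<close>.\<close>
definition aff_s :: "nat \<Rightarrow> nat \<Rightarrow> int \<Rightarrow> int" where
  "aff_s n i j =
     (if j mod int n = int i mod int n then j + 1
      else if j mod int n = (int i + 1) mod int n then j - 1
      else j)"

text \<open>Every integer is uniquely \<open>residue n k + n * quot n k\<close> with \<open>residue n k \<in> {1..n}\<close>.\<close>
definition residue :: "nat \<Rightarrow> int \<Rightarrow> int" where
  "residue n k = (k - 1) mod int n + 1"

definition quot :: "nat \<Rightarrow> int \<Rightarrow> int" where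
  "quot n k = (k - 1) div int n"

text \<open>A vector in \<open>\<int>\<^sup>n\<close> is a list of length \<open>n\<close>; the entry with (1-based) index \<open>i\<close> is
  \<open>\<mu> ! (i - 1)\<close>.\<close>
definition entry :: "'a list \<Rightarrow> nat \<Rightarrow> 'a" where
  "entry \<mu> i = \<mu> ! (i - 1)"

text \<open>The translation \<open>t\<^sub>\<mu>\<close>: the affine permutation with \<open>i \<mapsto> i + n \<mu>\<^sub>i\<close> for \<open>1 \<le> i \<le> n\<close>.\<close>
definition translation :: "nat \<Rightarrow> int list \<Rightarrow> int \<Rightarrow> int" where
  "translation n \<mu> k = k + int n * entry \<mu> (nat (residue n k))"

text \<open>The action on \<open>\<int>\<^sup>n\<close>: extend \<open>\<mu>\<close> to all of \<open>\<int>\<close> by \<open>\<mu>\<^sub>i\<^sub>+\<^sub>n = \<mu>\<^sub>i - 1\<close> and let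
  \<open>w\<close> act by \<open>(w \<mu>)\<^sub>i = \<mu>\<^sub>j\<close> with \<open>j = w\<^sup>-\<^sup>1(i)\<close>. The lemmas \<open>act_id\<close>, \<open>act_comp\<close>, \<open>act_aff_pi\<close>
  and \<open>act_aff_s\<close> below show that this is the group action which is given on the generators by
  \<open>\<pi> (\<mu>\<^sub>1, \<dots>, \<mu>\<^sub>n) = (\<mu>\<^sub>n + 1, \<mu>\<^sub>1, \<dots>, \<mu>\<^sub>n\<^sub>-\<^sub>1)\<close> and by \<open>s\<^sub>i\<close> exchanging the entries \<open>i\<close> and \<open>i + 1\<close>.\<close>
definition ext_entry :: "nat \<Rightarrow> int list \<Rightarrow> int \<Rightarrow> int" where
  "ext_entry n \<mu> k = entry \<mu> (nat (residue n k)) - quot n k"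

definition act :: "nat \<Rightarrow> (int \<Rightarrow> int) \<Rightarrow> int list \<Rightarrow> int list" where
  "act n w \<mu> = map (\<lambda>i. ext_entry n \<mu> (inv w (int i))) [1..<Suc n]"

section \<open>Inversions, length, words\<close>

definition Inv :: "nat \<Rightarrow> (int \<Rightarrow> int) \<Rightarrow> (int \<times> int) set" where
  "Inv n w = {(j, k). j \<in> {1..int n} \<and> j < k \<and> w j > w k}"

definition len :: "nat \<Rightarrow> (int \<Rightarrow> int) \<Rightarrow> nat" where
  "len n w = card (Inv n w)"

datatype basis = Eps int | K

definition affine_coroot :: "int \<Rightarrow> int \<Rightarrow> int \<Rightarrow> basis \<Rightarrow>\<^sub>0 int" where
  "affine_coroot i j m = frag_of (Eps i) - frag_of (Eps j) + frag_cmul m (frag_of K)"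

text \<open>The identification of \<open>(i, j + m n)\<close> with \<open>\<epsilon>\<^sub>i - \<epsilon>\<^sub>j + m K\<close>. On all pairs it is not injective
  (all \<open>(i, i + m n)\<close> go to \<open>m K\<close>), but such pairs are never inversions; see \<open>inj_on_coroot_of\<close>.\<close>
definition coroot_of :: "nat \<Rightarrow> int \<times> int \<Rightarrow> basis \<Rightarrow>\<^sub>0 int" where
  "coroot_of n = (\<lambda>(i, k). affine_coroot i (residue n k) (quot n k))"

datatype letter = Ls nat | Lpi

definition letters :: "nat \<Rightarrow> letter set" where
  "letters n = Ls ` {1..n - 1} \<union> {Lpi}"

fun letter_val :: "nat \<Rightarrow> letter \<Rightarrow> int \<Rightarrow> int" where
  "letter_val n (Ls i) = aff_s n i"
| "letter_val n Lpi = aff_pi"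

fun word_val :: "nat \<Rightarrow> letter list \<Rightarrow> int \<Rightarrow> int" where
  "word_val n [] = id"
| "word_val n (x # xs) = letter_val n x \<circ> word_val n xs"

definition reduced_word :: "nat \<Rightarrow> letter list \<Rightarrow> (int \<Rightarrow> int) \<Rightarrow> bool" where
  "reduced_word n xs w \<longleftrightarrow>
     set xs \<subseteq> letters n \<and> word_val n xs = w \<and> length (filter (\<lambda>x. x \<noteq> Lpi) xs) = len n w"

section \<open>Compositions\<close>

definition dg :: "nat \<Rightarrow> nat list \<Rightarrow> (nat \<times> nat) set" where
  "dg n \<mu> = {(i, j). 1 \<le> i \<and> i \<le> n \<and> 1 \<le> j \<and> j \<le> entry \<mu> i}"

definition u_elt :: "nat \<Rightarrow> nat list \<Rightarrow> int \<Rightarrow> int" where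
  "u_elt n \<mu> = (THE u. u \<in> affine_perms n \<and> act n u (replicate n 0) = map int \<mu> \<and>
     (\<forall>w \<in> affine_perms n. act n w (replicate n 0) = map int \<mu> \<longrightarrow> len n u \<le> len n w))"

definition v_elt :: "nat \<Rightarrow> nat list \<Rightarrow> int \<Rightarrow> int" where
  "v_elt n \<mu> = (THE v. v \<in> finite_perms n \<and> u_elt n \<mu> = translation n (map int \<mu>) \<circ> inv v)"

text \<open>The word \<open>s\<^sub>k \<cdots> s\<^sub>2 s\<^sub>1 \<pi>\<close>.\<close>
definition s_pi_word :: "nat \<Rightarrow> letter list" where
  "s_pi_word k = map Ls (rev [1..<Suc k]) @ [Lpi]"

text \<open>Here \<open>k\<close> is the number of leading zeros, so that \<open>\<mu> ! k\<close> is the first nonzero entry. The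
  recursion is restated without list surgery in \<open>box_greedy_zero\<close> and \<open>box_greedy_step\<close>.\<close>
function box_greedy :: "nat list \<Rightarrow> letter list" where
  "box_greedy \<mu> =
     (if \<forall>x \<in> set \<mu>. x = 0 then []
      else let k = length (takeWhile (\<lambda>x. x = 0) \<mu>) in
        s_pi_word k @ box_greedy (replicate k 0 @ drop (Suc k) \<mu> @ [\<mu> ! k - 1]))"
  by pat_completeness auto
termination
proof (relation "measure sum_list")
  fix \<mu> :: "nat list" and k
  assume nz: "\<not> (\<forall>x \<in> set \<mu>. x = 0)" and k: "k = length (takeWhile (\<lambda>x. x = 0) \<mu>)"
  have kl: "k < length \<mu>"
    using nz unfolding k by (induction \<mu>) auto
  have pos: "\<mu> ! k \<noteq> 0"
    using kl k nth_length_takeWhile by blast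
  have "sum_list \<mu> = sum_list (take k \<mu>) + \<mu> ! k + sum_list (drop (Suc k) \<mu>)"
    by (subst id_take_nth_drop[OF kl]) simp
  then have "sum_list (drop (Suc k) \<mu>) + (\<mu> ! k - 1) < sum_list \<mu>"
    using pos by linarith
  then show "(replicate k 0 @ drop (Suc k) \<mu> @ [\<mu> ! k - 1], \<mu>) \<in> measure sum_list"
    by (simp add: sum_list_replicate)
qed simp

declare box_greedy.simps [simp del]

lemma box_greedy_zero: "box_greedy (replicate n 0) = []"
  by (subst box_greedy.simps) simp

lemma box_greedy_step:
  assumes "1 \<le> k" and "m \<noteq> 0"
  shows "box_greedy (replicate (k - 1) 0 @ m # \<nu>) =
    s_pi_word (k - 1) @ box_greedy (replicate (k - 1) 0 @ \<nu> @ [m - 1])"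
proof -
  have "takeWhile (\<lambda>x. x = 0) (replicate (k - 1) 0 @ m # \<nu>) = replicate (k - 1) 0"
    using assms by (subst takeWhile_append2) auto
  then show ?thesis
    using assms by (subst box_greedy.simps) (simp add: nth_append Let_def)
qed

definition u_num :: "nat \<Rightarrow> nat list \<Rightarrow> nat \<Rightarrow> nat \<Rightarrow> nat" where
  "u_num n \<mu> i j =
     card {i' \<in> {1..i - 1}. entry \<mu> i' < j \<and> j \<le> entry \<mu> i} +
     card {i' \<in> {i + 1..n}. entry \<mu> i' < j - 1 \<and> j - 1 < entry \<mu> i}"

definition R_set :: "nat \<Rightarrow> nat list \<Rightarrow> nat \<Rightarrow> nat \<Rightarrow> (basis \<Rightarrow>\<^sub>0 int) set" where
  "R_set n \<mu> i j =
     {affine_coroot (v_elt n \<mu> (int i)) (int r) (int (entry \<mu> i) - int j + 1) | r.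
        r \<in> {1..u_num n \<mu> i j}}"

text \<open>The elements of \<open>dg n \<mu>\<close>, each once, in strictly increasing order of \<open>i + n j\<close>; see
  \<open>boxes_correct\<close>.\<close>
definition boxes :: "nat \<Rightarrow> nat list \<Rightarrow> (nat \<times> nat) list" where
  "boxes n \<mu> = sort_key (\<lambda>(i, j). i + n * j)
     (concat (map (\<lambda>i. map (Pair i) [1..<Suc (entry \<mu> i)]) [1..<Suc n]))"

section \<open>Adequacy of the encodings\<close>

lemma residue_quot: "residue n k + int n * quot n k = k"
  using mod_mult_div_eq[of "k - 1" "int n"] unfolding residue_def quot_def by linarith

lemma residue_range: "0 < n \<Longrightarrow> residue n k \<in> {1..int n}"
  using pos_mod_bound[of "int n" "k - 1"] pos_mod_sign[of "int n" "k - 1"]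
  unfolding residue_def atLeastAtMost_iff by linarith

lemma residue_shift: "residue n (k + int n * m) = residue n k"
proof -
  have *: "k + int n * m - 1 = (k - 1) + int n * m" by linarith
  show ?thesis unfolding residue_def * by (simp only: mod_mult_self2)
qed

lemma residue_eq:
  assumes "1 \<le> i" "i \<le> int n"
  shows "residue n (i + int n * m) = i"
proof -
  have "(i - 1) mod int n = i - 1" using assms by (intro mod_pos_pos_trivial) linarith+
  then show ?thesis unfolding residue_shift by (simp only: residue_def)
qed

lemma quot_eq:
  assumes "1 \<le> i" "i \<le> int n"
  shows "quot n (i + int n * m) = m"
proof -
  have n: "int n \<noteq> 0" using assms by linarith
  have *: "i + int n * m - 1 = (i - 1) + int n * m" by linarith
  have "(i - 1) div int n = 0" using assms by (intro div_pos_pos_trivial) linarith+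
  then show ?thesis unfolding quot_def * using div_mult_self2[OF n, of "i - 1" m] by linarith
qed

lemma affine_perms_shift:
  assumes "w \<in> affine_perms n"
  shows "w (i + int n * m) = w i + int n * m"
proof -
  have per: "w (i + int n) = w i + int n" for i
    using assms by (simp add: affine_perms_def)
  have nat: "w (i + int n * int m) = w i + int n * int m" for i m
  proof (induction m)
    case (Suc m)
    then show ?case using per[of "i + int n * int m"] by (simp add: algebra_simps)
  qed simp
  show ?thesis
  proof (cases "m \<ge> 0")
    case True
    then show ?thesis using nat[of i "nat m"] by simp
  next
    case False
    then show ?thesis using nat[of "i + int n * m" "nat (- m)"] by (simp add: algebra_simps)
  qed
qed

lemma affine_perms_id: "id \<in> affine_perms n"
  by (simp add: affine_perms_def)

lemma affine_perms_comp: "v \<in> affine_perms n \<Longrightarrow> w \<in> affine_perms n \<Longrightarrow> v \<circ> w \<in> affine_perms n"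
  by (auto simp: affine_perms_def bij_comp)

lemma affine_perms_inv:
  assumes "w \<in> affine_perms n"
  shows "inv w \<in> affine_perms n"
proof -
  have b: "bij w" using assms by (simp add: affine_perms_def)
  have "inv w (i + int n) = inv w i + int n" for i
    using affine_perms_shift[OF assms, of "inv w i" 1] b
    by (metis bij_inv_eq_iff mult.right_neutral)
  then show ?thesis using b by (simp add: affine_perms_def bij_imp_bij_inv)
qed

lemma aff_pi_mem: "aff_pi \<in> affine_perms n"
proof -
  have "bij aff_pi"
    by (rule o_bij[where g = "\<lambda>i. i - 1"]) (auto simp: aff_pi_def)
  then show ?thesis by (simp add: affine_perms_def aff_pi_def)
qed

lemma aff_s_invol:
  assumes "1 \<le> i" "i \<le> n - 1"
  shows "aff_s n i (aff_s n i j) = j"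
proof -
  have ne: "int i mod int n \<noteq> (int i + 1) mod int n"
  proof
    assume "int i mod int n = (int i + 1) mod int n"
    then have "int n dvd 1" by (metis mod_eq_dvd_iff add_diff_cancel_left' )
    then show False using assms by simp
  qed
  consider "j mod int n = int i mod int n" | "j mod int n = (int i + 1) mod int n"
    | "j mod int n \<noteq> int i mod int n" "j mod int n \<noteq> (int i + 1) mod int n" by blast
  then show ?thesis
  proof cases
    case 1
    then have "(j + 1) mod int n = (int i + 1) mod int n" by (metis mod_add_left_eq)
    then show ?thesis using 1 ne by (simp add: aff_s_def)
  next
    case 2
    then have "(j - 1) mod int n = int i mod int n"
      by (metis mod_diff_left_eq add_diff_cancel_right')
    then show ?thesis using 2 ne by (simp add: aff_s_def)
  next
    case 3
    then show ?thesis by (simp add: aff_s_def)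
  qed
qed

lemma aff_s_mem:
  assumes "1 \<le> i" "i \<le> n - 1"
  shows "aff_s n i \<in> affine_perms n"
proof -
  have "bij (aff_s n i)"
    by (rule o_bij[where g = "aff_s n i"]) (auto simp: aff_s_invol[OF assms])
  then show ?thesis by (simp add: affine_perms_def aff_s_def)
qed

lemma translation_mem:
  assumes "0 < n"
  shows "translation n \<mu> \<in> affine_perms n"
proof -
  define T where "T = (\<lambda>s k. k + int n * (s * entry \<mu> (nat (residue n k))))"
  note r = residue_shift[of n]
  have r': "residue n (k - int n * m) = residue n k" for k m
    using r[of k "- m"] by simp
  have TT: "T s (T (- s) k) = k" for s k
    by (simp add: T_def r r')
  have "bij (T 1)"
    by (rule o_bij[where g = "T (- 1)"]) (use TT[of 1] TT[of "- 1"] in auto)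
  moreover have "T 1 = translation n \<mu>" by (simp add: T_def translation_def fun_eq_iff)
  ultimately show ?thesis using r[of _ 1] by (simp add: affine_perms_def translation_def)
qed

lemma translation_apply:
  assumes "1 \<le> i" "i \<le> n"
  shows "translation n \<mu> (int i) = int i + int n * entry \<mu> i"
  using residue_eq[of "int i" n 0] assms by (simp add: translation_def)

lemma ext_entry_shift: "0 < n \<Longrightarrow> ext_entry n \<mu> (k + int n * m) = ext_entry n \<mu> k - m"
proof -
  assume n: "0 < n"
  have e: "k + int n * m = residue n k + int n * (quot n k + m)"
    using residue_quot[of n k] by (simp add: algebra_simps)
  then have "residue n (k + int n * m) = residue n k" "quot n (k + int n * m) = quot n k + m"
    using residue_range[OF n, of k] by (metis residue_eq atLeastAtMost_iff, metis e quot_eq atLeastAtMost_iff)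
  then show ?thesis by (simp add: ext_entry_def)
qed

lemma length_act [simp]: "length (act n w \<mu>) = n"
  by (simp add: act_def)

lemma entry_act:
  assumes "1 \<le> i" "i \<le> n"
  shows "entry (act n w \<mu>) i = ext_entry n \<mu> (inv w (int i))"
  using assms unfolding entry_def act_def by (subst nth_map) (auto simp: nth_upt simp del: upt_Suc)

lemma ext_entry_act:
  assumes "0 < n" "w \<in> affine_perms n"
  shows "ext_entry n (act n w \<mu>) k = ext_entry n \<mu> (inv w k)"
proof -
  have r: "1 \<le> nat (residue n k)" "nat (residue n k) \<le> n" "int (nat (residue n k)) = residue n k"
    using residue_range[OF assms(1), of k] by auto
  have "inv w k = inv w (residue n k) + int n * quot n k"
    using affine_perms_shift[OF affine_perms_inv[OF assms(2)], of "residue n k" "quot n k"]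
    by (simp add: residue_quot)
  then have "ext_entry n \<mu> (inv w k) = ext_entry n \<mu> (inv w (residue n k)) - quot n k"
    by (simp add: ext_entry_shift[OF assms(1)])
  then show ?thesis
    using entry_act[OF r(1,2), of w \<mu>] r(3) by (simp add: ext_entry_def[of n "act n w \<mu>"])
qed

lemma ext_entry_int: "1 \<le> i \<Longrightarrow> i \<le> n \<Longrightarrow> ext_entry n \<mu> (int i) = entry \<mu> i"
  using residue_eq[of "int i" n 0] quot_eq[of "int i" n 0] by (simp add: ext_entry_def)

lemma vec_eqI:
  assumes "length \<mu> = n" "length \<nu> = n" "\<And>i. 1 \<le> i \<Longrightarrow> i \<le> n \<Longrightarrow> entry \<mu> i = entry \<nu> i"
  shows "\<mu> = \<nu>"
proof (rule nth_equalityI)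
  fix i assume "i < length \<mu>"
  then show "\<mu> ! i = \<nu> ! i" using assms(1) assms(3)[of "Suc i"] by (simp add: entry_def)
qed (simp add: assms)

lemma act_id:
  assumes "length \<mu> = n"
  shows "act n id \<mu> = \<mu>"
  by (rule vec_eqI[of _ n]) (auto simp: assms entry_act ext_entry_int)

lemma act_comp:
  assumes "0 < n" "v \<in> affine_perms n" "w \<in> affine_perms n"
  shows "act n (v \<circ> w) \<mu> = act n v (act n w \<mu>)"
proof -
  have "bij v" "bij w" using assms by (auto simp: affine_perms_def)
  then have "inv (v \<circ> w) k = inv w (inv v k)" for k by (simp add: o_inv_distrib)
  then show ?thesis
    by (intro vec_eqI[of _ n]) (auto simp: entry_act ext_entry_act[OF assms(1,3)])
qed

lemma act_aff_pi:
  assumes "length \<mu> = n" "0 < n"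
  shows "act n aff_pi \<mu> = (last \<mu> + 1) # butlast \<mu>"
proof (rule vec_eqI[of _ n])
  fix i :: nat assume i: "1 \<le> i" "i \<le> n"
  have "aff_pi (int i - 1) = int i" by (simp add: aff_pi_def)
  then have "inv aff_pi (int i) = int i - 1"
    by (intro inv_f_eq) (auto simp: inj_def aff_pi_def)
  then have e: "entry (act n aff_pi \<mu>) i = ext_entry n \<mu> (int i - 1)"
    by (simp add: entry_act[OF i])
  show "entry (act n aff_pi \<mu>) i = entry ((last \<mu> + 1) # butlast \<mu>) i"
  proof (cases "i = 1")
    case True
    have "ext_entry n \<mu> (int n + int n * (-1)) = entry \<mu> n + 1"
      unfolding ext_entry_shift[OF assms(2)] using assms(2) by (simp add: ext_entry_int)
    then have "ext_entry n \<mu> 0 = entry \<mu> n + 1" by simp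
    moreover have "last \<mu> = entry \<mu> n"
      using assms by (auto simp: entry_def last_conv_nth)
    ultimately show ?thesis using e True by (simp add: entry_def)
  next
    case False
    then have "ext_entry n \<mu> (int (i - 1)) = entry \<mu> (i - 1)" using i by (intro ext_entry_int) auto
    then show ?thesis using e False i assms
      by (auto simp: entry_def nth_butlast nth_Cons' of_nat_diff)
  qed
qed (use assms in auto)

lemma act_aff_s:
  assumes "length \<mu> = n" "1 \<le> i" "i \<le> n - 1"
  shows "act n (aff_s n i) \<mu> = \<mu>[i - 1 := \<mu> ! i, i := \<mu> ! (i - 1)]"
proof (rule vec_eqI[of _ n])
  fix k :: nat assume k: "1 \<le> k" "k \<le> n"
  have "inv (aff_s n i) (int k) = aff_s n i (int k)"
    by (intro inv_f_eq inj_on_inverseI[of _ "aff_s n i"]) (rule aff_s_invol[OF assms(2,3)])+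
  moreover have "int k mod int n = int i mod int n \<longleftrightarrow> k = i"
    "int k mod int n = (int i + 1) mod int n \<longleftrightarrow> k = i + 1"
  proof -
    have *: "a mod n = b mod n \<longleftrightarrow> a = b" if "1 \<le> a" "a \<le> n" "1 \<le> b" "b \<le> n" for a b :: nat
      using that by (cases "a = n"; cases "b = n") auto
    show "int k mod int n = int i mod int n \<longleftrightarrow> k = i"
      using *[of k i] k assms by (simp flip: of_nat_mod)
    show "int k mod int n = (int i + 1) mod int n \<longleftrightarrow> k = i + 1"
    proof -
      have "int i + 1 = int (i + 1)" by simp
      moreover have "k mod n = (i + 1) mod n \<longleftrightarrow> k = i + 1" using *[of k "i + 1"] k assms by auto
      ultimately show ?thesis by (metis of_nat_eq_iff of_nat_mod)
    qed
  qed
  ultimately have "inv (aff_s n i) (int k) = int (if k = i then i + 1 else if k = i + 1 then i else k)"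
    by (simp add: aff_s_def)
  then have "entry (act n (aff_s n i) \<mu>) k
      = ext_entry n \<mu> (int (if k = i then i + 1 else if k = i + 1 then i else k))"
    by (simp only: entry_act[OF k])
  also have "\<dots> = entry \<mu> (if k = i then i + 1 else if k = i + 1 then i else k)"
    using k assms by (intro ext_entry_int) auto
  also have "\<dots> = entry (\<mu>[i - 1 := \<mu> ! i, i := \<mu> ! (i - 1)]) k"
    using k assms by (auto simp: entry_def nth_list_update)
  finally show "entry (act n (aff_s n i) \<mu>) k = entry (\<mu>[i - 1 := \<mu> ! i, i := \<mu> ! (i - 1)]) k" .
qed (use assms in auto)

lemma finite_Inv:
  assumes "0 < n" "w \<in> affine_perms n"
  shows "finite (Inv n w)"
proof -
  define B where "B = (\<Sum>i \<in> {1..int n}. \<bar>w i - i\<bar>)"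
  have B1: "\<bar>w i - i\<bar> \<le> B" if "i \<in> {1..int n}" for i
    unfolding B_def using that by (intro member_le_sum) auto
  have B2: "\<bar>w k - k\<bar> \<le> B" for k
    using affine_perms_shift[OF assms(2), of "residue n k" "quot n k"] residue_quot[of n k]
      B1[OF residue_range[OF assms(1), of k]] by (simp add: algebra_simps)
  have "Inv n w \<subseteq> {1..int n} \<times> {1..int n + 2 * B}"
  proof
    fix p assume "p \<in> Inv n w"
    then obtain j k where p: "p = (j, k)" "1 \<le> j" "j \<le> int n" "j < k" "w k < w j"
      by (auto simp: Inv_def)
    then show "p \<in> {1..int n} \<times> {1..int n + 2 * B}" using B2[of j] B2[of k] by auto
  qed
  then show ?thesis by (rule finite_subset) simp
qed

lemma inj_on_coroot_of:
  assumes "0 < n" "w \<in> affine_perms n"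
  shows "inj_on (coroot_of n) (Inv n w)"
proof (rule inj_onI)
  have ne: "residue n k \<noteq> j" if "(j, k) \<in> Inv n w" for j k
  proof
    assume r: "residue n k = j"
    then have k: "k = j + int n * quot n k" using residue_quot[of n k] by linarith
    then have "w k = w j + int n * quot n k"
      using affine_perms_shift[OF assms(2)] by metis
    then show False using that k by (simp add: Inv_def)
  qed
  have lk: "Poly_Mapping.lookup (coroot_of n (j, k)) (Eps i) =
        (if i = j then 1 else 0) - (if i = residue n k then 1 else 0)"
      "Poly_Mapping.lookup (coroot_of n (j, k)) K = quot n k" for i j k
    by (simp_all add: coroot_of_def affine_coroot_def lookup_add lookup_minus)
  fix p q assume p: "p \<in> Inv n w" and q: "q \<in> Inv n w" and eq: "coroot_of n p = coroot_of n q"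
  obtain j k j' k' where pq: "p = (j, k)" "q = (j', k')" by fastforce
  have 1: "residue n k \<noteq> j" "residue n k' \<noteq> j'" using ne p q pq by auto
  have 2: "Poly_Mapping.lookup (coroot_of n (j, k)) b = Poly_Mapping.lookup (coroot_of n (j', k')) b" for b
    using eq pq by simp
  have "j = j'" using 2[of "Eps j"] 1 by (simp add: lk split: if_splits)
  moreover have "residue n k = residue n k'"
    using 2[of "Eps (residue n k)"] 1 \<open>j = j'\<close> by (simp add: lk split: if_splits)
  moreover have "quot n k = quot n k'" using 2[of K] by (simp add: lk)
  ultimately show "p = q" using pq residue_quot[of n k] residue_quot[of n k'] by metis
qed

lemma finite_dg: "finite (dg n \<mu>)"
proof -
  have "dg n \<mu> = (SIGMA i:{1..n}. {1..entry \<mu> i})" by (auto simp: dg_def)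
  then show ?thesis by simp
qed

lemma boxes_correct:
  "set (boxes n \<mu>) = dg n \<mu>"
  "distinct (boxes n \<mu>)"
  "sorted_wrt (\<lambda>(i, j) (i', j'). i + n * j < i' + n * j') (boxes n \<mu>)"
proof -
  let ?key = "\<lambda>(i, j). i + n * j"
  let ?L = "\<lambda>A. concat (map (\<lambda>i. map (Pair i) [1..<Suc (entry \<mu> i)]) A)"
  have inj: "inj_on ?key (dg n \<mu>)"
  proof (rule inj_onI, clarify)
    fix i j i' j'
    assume m: "(i, j) \<in> dg n \<mu>" "(i', j') \<in> dg n \<mu>" and eq: "i + n * j = i' + n * j'"
    then have r: "1 \<le> int i" "int i \<le> int n" "1 \<le> int i'" "int i' \<le> int n"
      by (auto simp: dg_def)
    have e: "int i + int n * int j = int i' + int n * int j'"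
      using eq by (metis of_nat_add of_nat_mult)
    have "int i = int i'"
      using residue_eq[OF r(1,2), of "int j"] residue_eq[OF r(3,4), of "int j'"] unfolding e by argo
    moreover have "int j = int j'"
      using quot_eq[OF r(1,2), of "int j"] quot_eq[OF r(3,4), of "int j'"] unfolding e by argo
    ultimately show "i = i' \<and> j = j'" by simp
  qed
  show set: "set (boxes n \<mu>) = dg n \<mu>"
    unfolding boxes_def dg_def by (force simp del: upt_Suc)
  have "distinct (?L A)" if "distinct A" for A
    using that by (induction A) (auto simp: distinct_map inj_on_def)
  then show dist: "distinct (boxes n \<mu>)"
    unfolding boxes_def distinct_sort by (simp del: upt_Suc)
  have "distinct (map ?key (boxes n \<mu>))"
    using dist inj set by (simp only: distinct_map)
  moreover have "sorted (map ?key (boxes n \<mu>))"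
    unfolding boxes_def by (rule sorted_sort_key)
  ultimately have "sorted_wrt (<) (map ?key (boxes n \<mu>))"
    by (simp only: strict_sorted_iff)
  then show "sorted_wrt (\<lambda>(i, j) (i', j'). i + n * j < i' + n * j') (boxes n \<mu>)"
    by (simp only: sorted_wrt_map case_prod_unfold)
qed

end

theory Submission
  imports Defs
begin

text \<open>
  Lay the boxes of \<open>\<mu>\<close> out on the integers by putting box \<open>(i, j)\<close> at \<open>i + n j\<close>. Row \<open>i\<close> then
  starts from \<open>i\<close> and ends at \<open>i + n \<mu>\<^sub>i\<close>, and everything in the theorem can be read off from the \<open>n\<close>
  end positions. An affine permutation sends \<open>0\<close> to \<open>\<mu>\<close> exactly if it maps the window \<open>{1, \<dots>, n}\<close>
  onto the set of end positions (\<open>act_zero_iff\<close>), so these permutations differ only in the order in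
  which the window lists the end positions. The number of inversions that leave the window does not
  depend on that order, and the increasing order has no inversions inside the window; hence \<open>u\<^sub>\<mu>\<close> lists the end
  positions increasingly (\<open>u_elt_eq\<close>). This is the characterization from which all else follows.

  The number \<open>u\<^sub>\<mu>(i, j)\<close> counts the end positions below \<open>i + n (j - 1)\<close>, the place one step to the left
  of the box (\<open>u_num_eq\<close>): an earlier row ends there if its length is at most \<open>j - 1\<close>, a later row if
  its length is less than \<open>j - 1\<close>. Since \<open>u\<^sub>\<mu>\<close> is increasing on the window, the arguments at which it takes
  those values are \<open>1, \<dots>, u\<^sub>\<mu>(i, j)\<close>.

  Inversions. The value of \<open>u\<^sub>\<mu>\<close> at \<open>v\<^sub>\<mu>(i)\<close> is the end of row \<open>i\<close>. The pair \<open>(v\<^sub>\<mu>(i), r + n m)\<close> with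
  \<open>1 \<le> r \<le> n\<close> is an inversion only if \<open>m \<ge> 1\<close>, and then if and only if \<open>u\<^sub>\<mu>(r) < i + n (\<mu>\<^sub>i - m)\<close>. Writing
  \<open>m = \<mu>\<^sub>i - j + 1\<close> turns this into \<open>u\<^sub>\<mu>(r) < i + n (j - 1)\<close>, that is \<open>r \<le> u\<^sub>\<mu>(i, j)\<close>; so the inversions are
  indexed by a box and such an \<open>r\<close> (\<open>Inv_increasing_rep\<close>).

  The word. Let \<open>k\<close> be the number of leading zeros of \<open>\<mu>\<close>. The map \<open>s\<^sub>k \<cdots> s\<^sub>1 \<pi>\<close> fixes all integers of
  residue \<open>1, \<dots>, k\<close> and moves every integer of another residue to the next integer with residue outside
  \<open>1, \<dots>, k\<close>. It therefore carries the end positions of the shortened composition \<open>\<mu>'\<close> to those of \<open>\<mu>\<close>,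
  and likewise the boxes of \<open>\<mu>'\<close> to all boxes of \<open>\<mu>\<close> but the first one, \<open>(k + 1, 1)\<close>. It is not monotone
  on all of \<open>\<int>\<close>, but it is so on the positions that occur, because those with residue at most \<open>k\<close> are
  just \<open>1, \<dots>, k\<close> (\<open>cycle_strict_mono\<close>). So it preserves increasing listings, the reading order of
  boxes and the counts \<open>u(i, j)\<close>, and both the value of the greedy word and its factorization over the
  boxes follow by induction. The word is reduced because its number of simple transpositions and the
  number of inversions are the same sum over boxes.
\<close>

section \<open>Minimal coset representatives\<close>

text \<open>The position of the last box of row \<open>i\<close> when box \<open>(i, j)\<close> is placed at \<open>i + n j\<close>; an empty row ends at \<open>i\<close>.\<close>
definition end_pos :: "nat \<Rightarrow> nat list \<Rightarrow> nat \<Rightarrow> int" where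
  "end_pos n \<mu> i = int i + int n * int (entry \<mu> i)"

definition increasing_rep :: "nat \<Rightarrow> nat list \<Rightarrow> (int \<Rightarrow> int) \<Rightarrow> bool" where
  "increasing_rep n \<mu> w \<longleftrightarrow>
     w \<in> affine_perms n \<and> w ` {1..int n} = end_pos n \<mu> ` {1..n} \<and> strict_mono_on {1..int n} w"

lemma residue_quot_unique:
  assumes "i + int n * a = j + int n * b" "i \<in> {1..int n}" "j \<in> {1..int n}"
  shows "i = j \<and> a = b"
  using assms by (metis atLeastAtMost_iff residue_eq quot_eq)

lemma affine_perms_inj: "w \<in> affine_perms n \<Longrightarrow> w x = w y \<longleftrightarrow> x = y"
  by (auto simp: affine_perms_def bij_def dest: injD)

lemma affine_perms_eqI:
  assumes "0 < n" "v \<in> affine_perms n" "w \<in> affine_perms n"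
    and "\<And>i. i \<in> {1..int n} \<Longrightarrow> v i = w i"
  shows "v = w"
proof
  fix x
  show "v x = w x"
    using affine_perms_shift[OF assms(2), of "residue n x" "quot n x"]
      affine_perms_shift[OF assms(3), of "residue n x" "quot n x"]
      assms(4)[OF residue_range[OF assms(1), of x]]
    by (simp add: residue_quot)
qed

lemma inj_on_end_pos: "inj_on (end_pos n \<mu>) {1..n}"
proof (rule inj_onI)
  fix i j assume "i \<in> {1..n}" "j \<in> {1..n}" "end_pos n \<mu> i = end_pos n \<mu> j"
  then show "i = j"
    using residue_quot_unique[of "int i" n "int (entry \<mu> i)" "int j" "int (entry \<mu> j)"]
    by (simp add: end_pos_def)
qed

text \<open>The entry \<open>i\<close> of \<open>w \<cdot> 0\<close> says in which block of length \<open>n\<close> the preimage of \<open>i\<close> lies; translating by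
  a multiple of \<open>n\<close> brings that preimage into the window. One inclusion of sets suffices, as both have
  \<open>n\<close> elements.\<close>
lemma act_zero_iff:
  assumes n: "0 < n" and len: "length \<mu> = n" and w: "w \<in> affine_perms n"
  shows "act n w (replicate n 0) = map int \<mu> \<longleftrightarrow> w ` {1..int n} = end_pos n \<mu> ` {1..n}"
proof -
  have bw: "bij w" using w by (simp add: affine_perms_def)
  have ext0: "ext_entry n (replicate n 0) x = - quot n x" for x
    using residue_range[OF n, of x] by (auto simp: ext_entry_def entry_def)
  have "act n w (replicate n 0) = map int \<mu> \<longleftrightarrow>
      (\<forall>i\<in>{1..n}. entry (act n w (replicate n 0)) i = entry (map int \<mu>) i)"
    using vec_eqI[of "act n w (replicate n 0)" n "map int \<mu>"] len by auto
  also have "\<dots> \<longleftrightarrow> (\<forall>i\<in>{1..n}. quot n (inv w (int i)) = - int (entry \<mu> i))"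
    using len by (intro ball_cong) (auto simp: entry_act ext0, auto simp: entry_def)
  also have "\<dots> \<longleftrightarrow> w ` {1..int n} = end_pos n \<mu> ` {1..n}" (is "?L \<longleftrightarrow> ?R")
  proof
    assume L: ?L
    have "end_pos n \<mu> i \<in> w ` {1..int n}" if i: "i \<in> {1..n}" for i
    proof -
      let ?x = "inv w (int i)"
      have "w (residue n ?x) = end_pos n \<mu> i"
        using affine_perms_shift[OF w, of "residue n ?x" "quot n ?x"] L i bw
        by (simp add: residue_quot end_pos_def bij_is_surj surj_f_inv_f)
      then show ?thesis using residue_range[OF n, of ?x] by (metis imageI)
    qed
    moreover have "card (end_pos n \<mu> ` {1..n}) = card (w ` {1..int n})"
      using card_image[OF inj_on_end_pos, of n \<mu>] bw
      by (simp add: card_image bij_is_inj inj_on_subset[OF _ subset_UNIV])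
    ultimately show ?R by (intro card_subset_eq[symmetric]) auto
  next
    assume R: ?R
    show ?L
    proof
      fix i assume i: "i \<in> {1..n}"
      then obtain r where r: "r \<in> {1..int n}" "w r = end_pos n \<mu> i"
        using R by (metis imageE imageI)
      then have "w (r + int n * (- int (entry \<mu> i))) = int i"
        unfolding affine_perms_shift[OF w] by (simp add: end_pos_def)
      then have "inv w (int i) = r + int n * (- int (entry \<mu> i))"
        using bw by (metis bij_inv_eq_iff)
      then show "quot n (inv w (int i)) = - int (entry \<mu> i)"
        using r quot_eq[of r n "- int (entry \<mu> i)"] by simp
    qed
  qed
  finally show ?thesis .
qed

text \<open>Both functions list the same finite set in increasing order.\<close>
lemma strict_mono_on_image_unique:
  fixes f g :: "int \<Rightarrow> int"
  assumes "strict_mono_on {a..b} f" "strict_mono_on {a..b} g" "f ` {a..b} = g ` {a..b}"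
    and "x \<in> {a..b}"
  shows "f x = g x"
proof -
  have "sorted_wrt (<) (map h [a..b])" if "strict_mono_on {a..b} h" for h :: "int \<Rightarrow> int"
    unfolding sorted_wrt_map
    by (rule sorted_wrt_mono_rel[OF _ sorted_wrt_upto]) (use that in \<open>auto simp: strict_mono_on_def\<close>)
  then have "map f [a..b] = map g [a..b]"
    using assms by (intro strict_sorted_equal) auto
  then show ?thesis using assms(4) by auto
qed

lemma increasing_rep_unique:
  assumes "0 < n" "increasing_rep n \<mu> v" "increasing_rep n \<mu> w"
  shows "v = w"
  using assms unfolding increasing_rep_def
  by (intro affine_perms_eqI[OF assms(1)] strict_mono_on_image_unique[of 1 "int n"]) auto

lemma block_preserving_above:
  assumes "\<sigma> \<in> affine_perms n" "\<sigma> ` {1..int n} \<subseteq> {1..int n}" "0 < n" "int n < k"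
  shows "int n < \<sigma> k"
proof -
  have "1 \<le> quot n k"
    using residue_range[OF assms(3), of k] residue_quot[of n k] assms(3,4)
    by (smt (verit, best) atLeastAtMost_iff mult_less_cancel_left_pos mult.right_neutral of_nat_0_less_iff
          mult_nonneg_nonpos)
  moreover have "\<sigma> k = \<sigma> (residue n k) + int n * quot n k"
    using affine_perms_shift[OF assms(1), of "residue n k" "quot n k"] by (simp add: residue_quot)
  moreover have "1 \<le> \<sigma> (residue n k)"
    using assms(2) residue_range[OF assms(3), of k] by fastforce
  ultimately show ?thesis using mult_left_mono[of 1 "quot n k" "int n"] by linarith
qed

text \<open>Any other representative is \<open>w = u \<circ> \<sigma>\<^sup>-\<^sup>1\<close> with \<open>\<sigma>\<close> permuting the window. Applying \<open>\<sigma>\<close> to both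
  components embeds the inversions of \<open>u\<close>, which all have their second component beyond the window, into
  the inversions of \<open>w\<close> of that same kind. If \<open>w\<close> is no longer than \<open>u\<close>, it has no inversions inside
  the window, so it is increasing there as well.\<close>
lemma increasing_rep_minimal:
  assumes n: "0 < n" and u: "increasing_rep n \<mu> u"
    and w: "w \<in> affine_perms n" "w ` {1..int n} = end_pos n \<mu> ` {1..n}"
  shows "len n u \<le> len n w" and "len n w \<le> len n u \<Longrightarrow> w = u"
proof -
  have ua: "u \<in> affine_perms n" and um: "strict_mono_on {1..int n} u"
    and ui: "u ` {1..int n} = end_pos n \<mu> ` {1..n}"
    using u by (auto simp: increasing_rep_def)
  have bw: "bij w" using w by (simp add: affine_perms_def)
  define \<sigma> where "\<sigma> = inv w \<circ> u"
  have s: "\<sigma> \<in> affine_perms n"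
    unfolding \<sigma>_def by (intro affine_perms_comp affine_perms_inv w ua)
  have ws: "w (\<sigma> x) = u x" for x
    using bw by (simp add: \<sigma>_def bij_is_surj surj_f_inv_f)
  have si: "\<sigma> ` {1..int n} = {1..int n}"
    unfolding \<sigma>_def image_comp[symmetric] ui w(2)[symmetric]
    using bw by (simp add: bij_is_inj image_inv_f_f)
  (* the inversions of w that leave the window *)
  define B where "B = {(j, k) \<in> Inv n w. int n < k}"
  have "(\<lambda>(j, k). (\<sigma> j, \<sigma> k)) ` Inv n u \<subseteq> B"
  proof clarify
    fix j k assume jk: "(j, k) \<in> Inv n u"
    then have j: "j \<in> {1..int n}" "j < k" "u k < u j" by (auto simp: Inv_def)
    have "int n < k"
      using um j unfolding strict_mono_on_def by (smt (verit) atLeastAtMost_iff)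
    then have "int n < \<sigma> k"
      using block_preserving_above[OF s _ n] si by blast
    moreover have "\<sigma> j \<in> {1..int n}" using si j by blast
    ultimately show "(\<sigma> j, \<sigma> k) \<in> B" using j by (auto simp: B_def Inv_def ws)
  qed
  moreover have "inj_on (\<lambda>(j, k). (\<sigma> j, \<sigma> k)) (Inv n u)"
    by (auto simp: inj_on_def affine_perms_inj[OF s])
  moreover have BI: "B \<subseteq> Inv n w" "finite (Inv n w)"
    by (auto simp: B_def finite_Inv n w)
  ultimately have le: "len n u \<le> card B" "card B \<le> len n w"
    unfolding len_def by (auto intro: card_inj_on_le card_mono finite_subset)
  then show "len n u \<le> len n w" by simp
  assume "len n w \<le> len n u"
  then have BInv: "B = Inv n w" using le BI by (intro card_subset_eq) (auto simp: len_def)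
  have noinv: "\<not> w k < w j" if "j \<in> {1..int n}" "k \<in> {1..int n}" "j < k" for j k
  proof
    assume "w k < w j"
    then have "(j, k) \<in> Inv n w" using that by (simp add: Inv_def)
    then have "(j, k) \<in> B" using BInv by simp
    then show False using that by (simp add: B_def)
  qed
  have "w j < w k" if "j \<in> {1..int n}" "k \<in> {1..int n}" "j < k" for j k
    using noinv[OF that] affine_perms_inj[OF w(1), of j k] that by linarith
  then have "strict_mono_on {1..int n} w" by (simp add: strict_mono_on_def)
  then show "w = u" using w by (intro increasing_rep_unique[OF n _ u]) (simp add: increasing_rep_def)
qed

lemma u_elt_eq:
  assumes n: "0 < n" and len: "length \<mu> = n" and u: "increasing_rep n \<mu> u"
  shows "u_elt n \<mu> = u"
  unfolding u_elt_def
proof (rule the_equality)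
  show "u \<in> affine_perms n \<and> act n u (replicate n 0) = map int \<mu> \<and>
     (\<forall>w \<in> affine_perms n. act n w (replicate n 0) = map int \<mu> \<longrightarrow> len n u \<le> len n w)"
    using u increasing_rep_minimal(1)[OF n u] by (auto simp: act_zero_iff[OF n len] increasing_rep_def)
  then show "x = u" if "x \<in> affine_perms n \<and> act n x (replicate n 0) = map int \<mu> \<and>
     (\<forall>w \<in> affine_perms n. act n w (replicate n 0) = map int \<mu> \<longrightarrow> len n x \<le> len n w)" for x
    using that increasing_rep_minimal(2)[OF n u, of x] u
    unfolding act_zero_iff[OF n len] increasing_rep_def by (metis act_zero_iff[OF n len])
qed

lemma v_elt_spec:
  assumes n: "0 < n" and len: "length \<mu> = n" and u: "increasing_rep n \<mu> (u_elt n \<mu>)"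
  shows "v_elt n \<mu> \<in> finite_perms n"
    and "\<And>i. i \<in> {1..n} \<Longrightarrow> u_elt n \<mu> (v_elt n \<mu> (int i)) = end_pos n \<mu> i"
proof -
  define t where "t = translation n (map int \<mu>)"
  define v where "v = inv (u_elt n \<mu>) \<circ> t"
  have ua: "u_elt n \<mu> \<in> affine_perms n" using u by (simp add: increasing_rep_def)
  have ta: "t \<in> affine_perms n" unfolding t_def by (rule translation_mem[OF n])
  have bu: "bij (u_elt n \<mu>)" and bt: "bij t" using ua ta by (auto simp: affine_perms_def)
  have te: "t (int i) = end_pos n \<mu> i" if "i \<in> {1..n}" for i
    using that len translation_apply[of i n "map int \<mu>"] nth_map[of "i - 1" \<mu> int]
    by (auto simp: t_def end_pos_def entry_def)
  have "t ` {1..int n} = t ` int ` {1..n}" by (simp add: image_int_atLeastAtMost)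
  also have "\<dots> = u_elt n \<mu> ` {1..int n}"
    using te u by (simp add: increasing_rep_def image_image)
  finally have "v ` {1..int n} = {1..int n}"
    unfolding v_def image_comp[symmetric] using bu by (simp add: bij_is_inj image_inv_f_f)
  then have vf: "v \<in> finite_perms n"
    unfolding finite_perms_def v_def by (auto intro!: affine_perms_comp affine_perms_inv ua ta)
  have iv: "inv v = inv t \<circ> u_elt n \<mu>"
    unfolding v_def using bu bt by (simp add: o_inv_distrib bij_imp_bij_inv inv_inv_eq)
  have "v_elt n \<mu> = v"
    unfolding v_elt_def t_def[symmetric]
  proof (rule the_equality)
    show "v \<in> finite_perms n \<and> u_elt n \<mu> = t \<circ> inv v"
      using vf bt by (auto simp: iv fun_eq_iff bij_is_surj surj_f_inv_f)
    fix x assume x: "x \<in> finite_perms n \<and> u_elt n \<mu> = t \<circ> inv x"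
    then have bx: "bij x" by (simp add: finite_perms_def affine_perms_def)
    have "inv x = inv v"
      using x bt by (auto simp: iv fun_eq_iff bij_is_inj inv_f_f)
    then have "inv (inv x) = inv (inv v)" by simp
    moreover have "bij v" using vf by (simp add: finite_perms_def affine_perms_def)
    ultimately show "x = v" using bx by (simp add: inv_inv_eq)
  qed
  then show "v_elt n \<mu> \<in> finite_perms n" using vf by simp
  show "u_elt n \<mu> (v_elt n \<mu> (int i)) = end_pos n \<mu> i" if "i \<in> {1..n}" for i
    using \<open>v_elt n \<mu> = v\<close> te[OF that] bu by (simp add: v_def bij_is_surj surj_f_inv_f)
qed

section \<open>Inversions\<close>

text \<open>End positions are ordered lexicographically by row length, then row number. The hypothesis
  \<open>j \<le> \<mu>\<^sub>i\<close> keeps row \<open>i\<close> itself from being counted.\<close>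
lemma u_num_eq:
  assumes "1 \<le> j" "j \<le> entry \<mu> i" "i \<in> {1..n}"
  shows "u_num n \<mu> i j = card {i' \<in> {1..n}. end_pos n \<mu> i' < int i + int n * (int j - 1)}"
proof -
  let ?A = "{i' \<in> {1..i - 1}. entry \<mu> i' < j \<and> j \<le> entry \<mu> i}"
  let ?B = "{i' \<in> {i + 1..n}. entry \<mu> i' < j - 1 \<and> j - 1 < entry \<mu> i}"
  have lex: "a + int n * c < b + int n * d \<longleftrightarrow> c < d \<or> c = d \<and> a < b"
    if "a \<in> {1..int n}" "b \<in> {1..int n}" for a b c d
  proof -
    have "int n * c + int n \<le> int n * d" if "c < d" for c d
      using mult_left_mono[of "c + 1" d "int n"] that by (simp add: algebra_simps)
    from this[of c d] this[of d c] show ?thesis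
      using that by (cases c d rule: linorder_cases) auto
  qed
  have "{i' \<in> {1..n}. end_pos n \<mu> i' < int i + int n * (int j - 1)} = ?A \<union> ?B"
  proof (rule set_eqI)
    fix x
    show "x \<in> {i' \<in> {1..n}. end_pos n \<mu> i' < int i + int n * (int j - 1)} \<longleftrightarrow> x \<in> ?A \<union> ?B"
      using assms lex[of "int x" "int i" "int (entry \<mu> x)" "int j - 1"]
      by (cases x i rule: linorder_cases) (auto simp: end_pos_def)
  qed
  moreover have "card (?A \<union> ?B) = u_num n \<mu> i j"
    unfolding u_num_def by (rule card_Un_disjoint) auto
  ultimately show ?thesis by simp
qed

lemma initial_segment:
  fixes n :: nat and S :: "int set"
  assumes "S \<subseteq> {1..int n}" "\<And>x y. y \<in> S \<Longrightarrow> 1 \<le> x \<Longrightarrow> x \<le> y \<Longrightarrow> x \<in> S"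
  shows "S = {1..int (card S)}"
proof (cases "S = {}")
  case False
  have fin: "finite S" using assms(1) by (rule finite_subset) simp
  have "S = {1..Max S}"
    using Max_in[OF fin False] Max_ge[OF fin] assms(1) by (auto intro: assms(2))
  moreover have "1 \<le> Max S" using Max_in[OF fin False] assms(1) by auto
  moreover have "int (card {1..Max S}) = Max S" using calculation(2) by simp
  ultimately show ?thesis by metis
qed simp

text \<open>An increasing listing takes its values below any bound on an initial segment of the window, whose
  length is the number of such values.\<close>
lemma increasing_rep_less_iff:
  assumes u: "increasing_rep n \<mu> u" and "(i, j) \<in> dg n \<mu>"
  shows "{r \<in> {1..int n}. u r < int i + int n * (int j - 1)} = {1..int (u_num n \<mu> i j)}"
proof -
  let ?b = "int i + int n * (int j - 1)"
  let ?S = "{r \<in> {1..int n}. u r < ?b}"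
  have ua: "u \<in> affine_perms n" and um: "strict_mono_on {1..int n} u"
    and ui: "u ` {1..int n} = end_pos n \<mu> ` {1..n}"
    using u by (auto simp: increasing_rep_def)
  have "u x \<le> u y" if "x \<le> y" "x \<in> {1..int n}" "y \<in> {1..int n}" for x y
    using um that by (metis strict_mono_onD order_le_less)
  then have "?S = {1..int (card ?S)}"
    by (intro initial_segment) (fastforce)+
  moreover have "card ?S = card (u ` ?S)"
    by (intro card_image[symmetric] inj_onI) (simp add: affine_perms_inj[OF ua])
  moreover have "u ` ?S = {x \<in> u ` {1..int n}. x < ?b}" by auto
  moreover have "\<dots> = end_pos n \<mu> ` {i' \<in> {1..n}. end_pos n \<mu> i' < ?b}" unfolding ui by auto
  moreover have "card (end_pos n \<mu> ` {i' \<in> {1..n}. end_pos n \<mu> i' < ?b}) = u_num n \<mu> i j"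
    using assms(2) by (subst card_image[OF inj_on_subset[OF inj_on_end_pos]])
       (auto simp: u_num_eq dg_def)
  ultimately show ?thesis by metis
qed

lemma u_num_less:
  assumes "(i, j) \<in> dg n \<mu>"
  shows "u_num n \<mu> i j < n"
proof -
  have "{i' \<in> {1..n}. end_pos n \<mu> i' < int i + int n * (int j - 1)} \<subseteq> {1..n} - {i}"
    using assms mult_left_mono[of "int j - 1" "int (entry \<mu> i)" "int n"]
    by (auto simp: dg_def end_pos_def)
  then have "card {i' \<in> {1..n}. end_pos n \<mu> i' < int i + int n * (int j - 1)} \<le> card ({1..n} - {i})"
    by (intro card_mono) auto
  then show ?thesis using assms by (auto simp: dg_def u_num_eq)
qed

text \<open>The box \<open>(i, j)\<close> contributes the inversions between the end of row \<open>i\<close> and those end positions that stay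
  below it after moving \<open>\<mu>\<^sub>i - j + 1\<close> blocks to the right. For surjectivity, the number \<open>m\<close> of blocks between the two
  arguments determines the column \<open>j = \<mu>\<^sub>i - m + 1\<close>: it is at most \<open>\<mu>\<^sub>i\<close> since \<open>u\<close> is increasing on the
  window, and at least \<open>1\<close> since the values of \<open>u\<close> on the window are positive.\<close>
lemma Inv_increasing_rep:
  assumes n: "0 < n" and u: "increasing_rep n \<mu> u"
    and v: "v \<in> finite_perms n" "\<And>i. i \<in> {1..n} \<Longrightarrow> u (v (int i)) = end_pos n \<mu> i"
  defines "P \<equiv> \<lambda>((i, j), r). (v (int i), int r + int n * (int (entry \<mu> i) - int j + 1))"
  shows "bij_betw P (SIGMA (i, j):dg n \<mu>. {1..u_num n \<mu> i j}) (Inv n u)"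
proof -
  let ?D = "SIGMA (i, j):dg n \<mu>. {1..u_num n \<mu> i j}"
  have ua: "u \<in> affine_perms n" and um: "strict_mono_on {1..int n} u"
    and ui: "u ` {1..int n} = end_pos n \<mu> ` {1..n}"
    using u by (auto simp: increasing_rep_def)
  have va: "v \<in> affine_perms n" and vi: "v ` {1..int n} = {1..int n}"
    using v by (auto simp: finite_perms_def)
  have "(i = i' \<and> j = j') \<and> r = r'"
    if a: "(i, j) \<in> dg n \<mu>" "r \<in> {1..u_num n \<mu> i j}" "(i', j') \<in> dg n \<mu>"
      "r' \<in> {1..u_num n \<mu> i' j'}" and eq: "P ((i, j), r) = P ((i', j'), r')" for i j r i' j' r'
  proof -
    have "i = i'" using eq by (simp add: P_def affine_perms_inj[OF va])
    moreover have "int r \<in> {1..int n}" "int r' \<in> {1..int n}"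
      using a u_num_less[OF a(1)] u_num_less[OF a(3)] by auto
    ultimately show ?thesis
      using eq residue_quot_unique[of "int r" n "int (entry \<mu> i) - int j + 1" "int r'"
        "int (entry \<mu> i') - int j' + 1"] by (auto simp: P_def)
  qed
  then have "inj_on P ?D" unfolding inj_on_def by fast
  moreover have "P ((i, j), r) \<in> Inv n u"
    if a: "(i, j) \<in> dg n \<mu>" "r \<in> {1..u_num n \<mu> i j}" for i j r
  proof -
    let ?m = "int (entry \<mu> i) - int j + 1"
    have i: "i \<in> {1..n}" and m: "1 \<le> ?m" using a by (auto simp: dg_def)
    have vr: "v (int i) \<in> {1..int n}" using vi i by auto
    have "int r \<in> {r \<in> {1..int n}. u r < int i + int n * (int j - 1)}"
      unfolding increasing_rep_less_iff[OF u a(1)] using a(2) by simp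
    then have r: "1 \<le> int r" "u (int r) < int i + int n * (int j - 1)" by simp_all
    have "int n * 1 \<le> int n * ?m" using m by (intro mult_left_mono) auto
    then have "v (int i) < int r + int n * ?m" using vr r(1) unfolding atLeastAtMost_iff by linarith
    moreover have "u (int r + int n * ?m) < u (v (int i))"
      unfolding affine_perms_shift[OF ua] v(2)[OF i] end_pos_def
      using r(2) by (simp add: algebra_simps)
    ultimately show ?thesis using vr by (simp add: P_def Inv_def)
  qed
  then have "P x \<in> Inv n u" if "x \<in> ?D" for x
    using that by (cases x; cases "fst x") simp
  then have "P ` ?D \<subseteq> Inv n u" by (rule image_subsetI)
  moreover have "Inv n u \<subseteq> P ` ?D"
  proof clarify
    fix a b assume ab: "(a, b) \<in> Inv n u"
    then have a: "a \<in> {1..int n}" "a < b" "u b < u a" by (auto simp: Inv_def)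
    obtain x where x: "x \<in> {1..int n}" "a = v x" using a(1) vi by (metis imageE)
    define i where "i = nat x"
    have i: "i \<in> {1..n}" "a = v (int i)" unfolding i_def using x by (simp_all add: le_nat_iff nat_le_iff)
    define r where "r = residue n b"
    define m where "m = quot n b"
    have r: "r \<in> {1..int n}" unfolding r_def by (rule residue_range[OF n])
    have b: "b = r + int n * m" by (simp add: r_def m_def residue_quot)
    have ub: "u r + int n * m < int i + int n * int (entry \<mu> i)"
      using a(3) by (simp add: b i v(2)[OF i(1)] affine_perms_shift[OF ua] end_pos_def)
    have "0 \<le> m"
    proof (rule ccontr)
      assume "\<not> 0 \<le> m"
      then have "int n * m \<le> int n * (- 1)" by (intro mult_left_mono) auto
      then show False using a r b by auto
    qed
    moreover have "m \<noteq> 0"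
    proof
      assume "m = 0"
      then have "a < r" using a b by simp
      then have "u a < u r" using um a(1) r by (auto simp: strict_mono_on_def)
      then show False using a b \<open>m = 0\<close> by simp
    qed
    moreover have "m \<le> int (entry \<mu> i)"
    proof (rule ccontr)
      assume "\<not> m \<le> int (entry \<mu> i)"
      then have "int n * (int (entry \<mu> i) + 1) \<le> int n * m" by (intro mult_left_mono) auto
      moreover have "1 \<le> u r"
      proof -
        obtain i' where "i' \<in> {1..n}" "u r = end_pos n \<mu> i'" using ui r by (metis imageE imageI)
        then have "int 1 \<le> int i'" "u r = int i' + int (n * entry \<mu> i')" by (auto simp: end_pos_def)
        then show ?thesis by linarith
      qed
      ultimately show False using ub i by (simp add: algebra_simps)
    qed
    ultimately have m: "1 \<le> m" "m \<le> int (entry \<mu> i)" by auto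
    define j where "j = nat (int (entry \<mu> i) - m + 1)"
    have j: "int j = int (entry \<mu> i) - m + 1" using m by (simp add: j_def)
    then have d: "(i, j) \<in> dg n \<mu>" using i m by (auto simp: dg_def)
    have "u r < int i + int n * (int j - 1)" using ub by (simp add: j algebra_simps)
    then have "r \<in> {r \<in> {1..int n}. u r < int i + int n * (int j - 1)}" using r by simp
    then have "r \<in> {1..int (u_num n \<mu> i j)}" unfolding increasing_rep_less_iff[OF u d] .
    then have "((i, j), nat r) \<in> ?D" using d by auto
    moreover have "P ((i, j), nat r) = (a, b)" using r by (simp add: P_def b i j)
    ultimately show "(a, b) \<in> P ` ?D" by (metis imageI)
  qed
  ultimately show ?thesis by (auto simp: bij_betw_def)
qed

section \<open>One step of the greedy recursion\<close>

text \<open>The value of \<open>s\<^sub>k \<cdots> s\<^sub>1 \<pi>\<close>. On residues greater than \<open>k\<close> it is the successor within the set of such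
  integers, which from residue \<open>n\<close> has to skip \<open>k\<close> places.\<close>
definition cycle :: "nat \<Rightarrow> nat \<Rightarrow> int \<Rightarrow> int" where
  "cycle n k x =
     (if residue n x \<le> int k then x else if residue n x < int n then x + 1 else x + int k + 1)"

lemma cycle_eq:
  assumes "r \<in> {1..int n}"
  shows "cycle n k (r + int n * q) =
    (if r \<le> int k then r else if r < int n then r + 1 else int n + int k + 1) + int n * q"
  using assms residue_eq[of r n q] by (auto simp: cycle_def)

lemma aff_s_eq:
  assumes "1 \<le> i" "i \<le> n - 1" "r \<in> {1..int n}"
  shows "aff_s n i (r + int n * q) =
    (if r = int i then r + 1 else if r = int i + 1 then r - 1 else r) + int n * q"
proof -
  have "(r + int n * q) mod int n = c mod int n \<longleftrightarrow> r = c" if "c \<in> {1..int n}" for c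
  proof -
    have "r = c" if "int n dvd r - c"
      using dvd_imp_le_int[OF _ that] assms(3) \<open>c \<in> {1..int n}\<close> by fastforce
    then show ?thesis by (auto simp: mod_eq_dvd_iff)
  qed
  from this[of "int i"] this[of "int i + 1"] show ?thesis
    using assms by (auto simp: aff_s_def)
qed

lemma word_val_s_pi_word: "k < n \<Longrightarrow> word_val n (s_pi_word k) = cycle n k"
proof (induction k)
  case 0
  have "aff_pi x = cycle n 0 x" for x
    using residue_range[OF 0, of x] by (auto simp: aff_pi_def cycle_def)
  then show ?case by (auto simp: s_pi_word_def)
next
  case (Suc k)
  have "aff_s n (Suc k) (cycle n k x) = cycle n (Suc k) x" for x
  proof -
    define r q where "r = residue n x" and "q = quot n x"
    have x: "x = r + int n * q" by (simp add: r_def q_def residue_quot)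
    have r: "r \<in> {1..int n}" unfolding r_def using Suc.prems by (intro residue_range) simp
    consider "r \<le> int k" | "int k < r" "r < int n" | "r = int n" using r by force
    then show ?thesis
    proof cases
      case 3
      have "aff_s n (Suc k) ((int k + 1) + int n * (q + 1)) = int k + 2 + int n * (q + 1)"
        using Suc.prems by (subst aff_s_eq) auto
      then show ?thesis
        unfolding x cycle_eq[OF r] using 3 Suc.prems by (simp add: algebra_simps)
    next
      case 1
      then show ?thesis
        unfolding x cycle_eq[OF r] using Suc.prems r aff_s_eq[of "Suc k" n r q] by simp
    next
      case 2
      then show ?thesis
        unfolding x cycle_eq[OF r] using Suc.prems r aff_s_eq[of "Suc k" n "r + 1" q] by simp
    qed
  qed
  then show ?case using Suc by (simp add: s_pi_word_def fun_eq_iff)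
qed

lemma word_val_mem: "set xs \<subseteq> letters n \<Longrightarrow> word_val n xs \<in> affine_perms n"
proof (induction xs)
  case (Cons x xs)
  then have "letter_val n x \<in> affine_perms n"
    using aff_s_mem[of _ n] by (auto simp: letters_def aff_pi_mem)
  then show ?case using Cons by (simp del: comp_apply add: affine_perms_comp)
qed (simp add: affine_perms_id)

lemma word_val_append: "word_val n (xs @ ys) = word_val n xs \<circ> word_val n ys"
  by (induction xs) auto

lemma s_pi_word_letters: "k < n \<Longrightarrow> set (s_pi_word k) \<subseteq> letters n"
  by (auto simp: s_pi_word_def letters_def)

text \<open>The only failures of monotonicity of \<open>cycle n k\<close> come from residue \<open>n\<close> jumping over the fixed residues
  \<open>1, \<dots>, k\<close> of the next block. Among positive integers they disappear once the fixed points beyond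
  \<open>k\<close> are removed.\<close>
abbreviation cycle_dom :: "nat \<Rightarrow> nat \<Rightarrow> int set" where
  "cycle_dom n k \<equiv> {x. 1 \<le> x \<and> (x \<le> int k \<or> int k < residue n x)}"

lemma cycle_strict_mono:
  assumes "k < n"
  shows "strict_mono_on (cycle_dom n k) (cycle n k)"
proof (rule strict_mono_onI)
  fix x y
  assume x: "x \<in> cycle_dom n k"
    and y: "y \<in> cycle_dom n k" and xy: "x < y"
  have n: "0 < n" using assms by simp
  have small: "residue n z = z" if "1 \<le> z" "z \<le> int k" for z
    using residue_eq[of z n 0] that assms by simp
  have ge: "z \<le> cycle n k z" for z by (simp add: cycle_def)
  show "cycle n k x < cycle n k y"
  proof (cases "x \<le> int k")
    case True
    then have "cycle n k x = x" using x small by (simp add: cycle_def)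
    then show ?thesis using xy ge[of y] by simp
  next
    case False
    then have ry: "int k < residue n y" and rx: "int k < residue n x" using x y xy by auto
    have gy: "y < cycle n k y" using ry by (simp add: cycle_def)
    show ?thesis
    proof (cases "residue n x < int n")
      case True
      then show ?thesis using rx xy gy by (simp add: cycle_def)
    next
      case F: False
      have rn: "residue n x = int n" using F residue_range[OF n, of x] by simp
      have "int n * (quot n x + 1) < y" using xy residue_quot[of n x] rn by (simp add: algebra_simps)
      also have "y \<le> int n * (quot n y + 1)"
        using residue_quot[of n y] residue_range[OF n, of y] by (simp add: algebra_simps)
      finally have "quot n x + 1 \<le> quot n y" using n by (simp add: mult_less_cancel_left)
      then have "int n * (quot n x + 1) \<le> int n * quot n y" by (intro mult_left_mono) auto
      then have "x + int k + 1 \<le> y"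
        using residue_quot[of n x] residue_quot[of n y] rn ry by (simp add: algebra_simps)
      then show ?thesis using rn rx gy by (simp add: cycle_def)
    qed
  qed
qed

text \<open>How rows and boxes of the shortened composition sit inside the original one: the last row is the
  original row \<open>k + 1\<close> without its first box, and the rows \<open>k + 1, \<dots>, n - 1\<close> are the original ones from
  one index higher.\<close>
definition shift_row :: "nat \<Rightarrow> nat \<Rightarrow> nat \<Rightarrow> nat" where
  "shift_row n k i = (if i \<le> k then i else if i < n then i + 1 else k + 1)"

definition shift_box :: "nat \<Rightarrow> nat \<Rightarrow> nat \<times> nat \<Rightarrow> nat \<times> nat" where
  "shift_box n k = (\<lambda>(i, j). (shift_row n k i, if i = n then j + 1 else j))"

lemma bij_betw_shift_row: "k < n \<Longrightarrow> bij_betw (shift_row n k) {1..n} {1..n}"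
  by (rule bij_betw_byWitness[where
        f' = "\<lambda>i. if i \<le> k then i else if i = k + 1 then n else i - 1"])
    (auto simp: shift_row_def)

text \<open>One step of the recursion replaces the composition \<open>before\<close>, whose first nonzero entry stands at
  \<open>k + 1\<close>, by \<open>after\<close>.\<close>
locale greedy_step =
  fixes n k m :: nat and \<nu> :: "nat list"
  assumes n_eq: "n = Suc (k + length \<nu>)"
begin

abbreviation "before \<equiv> replicate k 0 @ Suc m # \<nu>"
abbreviation "after \<equiv> replicate k 0 @ \<nu> @ [m]"

lemma k_less: "k < n" using n_eq by simp

lemma entry_before:
  "1 \<le> i \<Longrightarrow> i \<le> k \<Longrightarrow> entry before i = 0"
  "entry before (Suc k) = Suc m"
  by (auto simp: entry_def nth_append)

lemma entry_after:
  assumes "1 \<le> i" "i \<le> n"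
  shows "entry after i = (if i = n then m else entry before (shift_row n k i))"
  using assms n_eq by (auto simp: entry_def nth_append shift_row_def nth_Cons')

lemma end_pos_shift_row:
  assumes "i \<in> {1..n}"
  shows "end_pos n before (shift_row n k i) = cycle n k (end_pos n after i)"
  using assms k_less entry_after[of i] entry_before
  by (auto simp: end_pos_def cycle_eq) (auto simp: shift_row_def algebra_simps)

text \<open>The first \<open>k\<close> rows are empty, so their end positions are \<open>1, \<dots>, k\<close>.\<close>
lemma end_pos_in_dom: "i \<in> {1..n} \<Longrightarrow> end_pos n after i \<in> cycle_dom n k"
  using entry_after[of i] entry_before(1)[of i] k_less residue_eq[of "int i" n "int (entry after i)"]
  by (auto simp: end_pos_def shift_row_def simp flip: of_nat_mult)

lemma increasing_rep_step:
  assumes "increasing_rep n after w"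
  shows "increasing_rep n before (cycle n k \<circ> w)"
  unfolding increasing_rep_def
proof (intro conjI)
  have w: "w \<in> affine_perms n" "w ` {1..int n} = end_pos n after ` {1..n}"
    "strict_mono_on {1..int n} w" using assms by (auto simp: increasing_rep_def)
  show "cycle n k \<circ> w \<in> affine_perms n"
    using word_val_mem[OF s_pi_word_letters[OF k_less]] w(1)
    by (simp add: word_val_s_pi_word k_less affine_perms_comp)
  have "(cycle n k \<circ> w) ` {1..int n} = (\<lambda>i. end_pos n before (shift_row n k i)) ` {1..n}"
    unfolding image_comp[symmetric] w(2) unfolding image_comp
    by (intro image_cong) (auto simp: end_pos_shift_row)
  also have "\<dots> = end_pos n before ` {1..n}"
    using bij_betw_shift_row[OF k_less] unfolding bij_betw_def by (metis image_image)
  finally show "(cycle n k \<circ> w) ` {1..int n} = end_pos n before ` {1..n}" .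
  have "w x \<in> cycle_dom n k" if "x \<in> {1..int n}" for x
  proof -
    have "w x \<in> end_pos n after ` {1..n}" using that w(2) by (metis imageI)
    then obtain i where "i \<in> {1..n}" "w x = end_pos n after i" by (rule imageE)
    then show ?thesis using end_pos_in_dom[of i] by simp
  qed
  then show "strict_mono_on {1..int n} (cycle n k \<circ> w)"
    by (intro strict_mono_onI) (simp only: o_apply strict_mono_onD[OF cycle_strict_mono[OF k_less]]
        strict_mono_onD[OF w(3)])
qed

lemma dg_after_row: "(i, j) \<in> dg n after \<Longrightarrow> k < i"
  using entry_after[of i] entry_before(1)[of i] k_less
  by (cases "i \<le> k") (auto simp: dg_def shift_row_def)

lemma dg_before: "dg n before = insert (Suc k, 1) (shift_box n k ` dg n after)"
proof (intro equalityI subsetI)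
  fix b assume b: "b \<in> dg n before"
  obtain i j where ij: "b = (i, j)" by fastforce
  have i: "1 \<le> i" "i \<le> n" "1 \<le> j" "j \<le> entry before i" using b by (auto simp: ij dg_def)
  then have ki: "k < i" using entry_before(1)[of i] by (cases "i \<le> k") auto
  show "b \<in> insert (Suc k, 1) (shift_box n k ` dg n after)"
  proof (cases "i = Suc k")
    case True
    have "b = shift_box n k (n, j - 1)" if "j \<noteq> 1"
      using that True i k_less by (auto simp: ij shift_box_def shift_row_def)
    moreover have "(n, j - 1) \<in> dg n after" if "j \<noteq> 1"
      using that True i k_less entry_before(2) entry_after[of n] by (auto simp: dg_def)
    ultimately show ?thesis using True ij by blast
  next
    case False
    have "b = shift_box n k (i - 1, j)"
      using False i ki by (auto simp: ij shift_box_def shift_row_def)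
    moreover have "(i - 1, j) \<in> dg n after"
      using False i ki entry_after[of "i - 1"] by (auto simp: dg_def shift_row_def)
    ultimately show ?thesis by blast
  qed
next
  fix b assume "b \<in> insert (Suc k, 1) (shift_box n k ` dg n after)"
  then consider "b = (Suc k, 1)" | i j where "(i, j) \<in> dg n after" "b = shift_box n k (i, j)" by auto
  then show "b \<in> dg n before"
  proof cases
    case 1
    then show ?thesis using k_less entry_before(2) by (simp add: dg_def)
  next
    case 2
    then show ?thesis using dg_after_row[OF 2(1)] k_less entry_after[of i] entry_before(2)
      by (auto simp: dg_def shift_box_def shift_row_def split: if_splits)
  qed
qed

text \<open>The column offset \<open>c\<close> is \<open>0\<close> for the reading order of the boxes and \<open>1\<close> for the bound in
  \<open>u_num_eq\<close>.\<close>
lemma box_pos_shift_box: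
  assumes "k < i" "1 \<le> i" "i \<le> n" "shift_box n k (i, j) = (i', j')"
  shows "int i' + int n * (int j' - c) = cycle n k (int i + int n * (int j - c))"
  using assms k_less by (auto simp: cycle_eq) (auto simp: shift_box_def shift_row_def algebra_simps)

lemma box_pos_in_dom:
  assumes "(i, j) \<in> dg n after" "c \<le> 1"
  shows "int i + int n * (int j - c) \<in> cycle_dom n k"
proof -
  have "0 \<le> int n * (int j - c)" using assms by (auto simp: dg_def)
  then show ?thesis
    using assms dg_after_row[OF assms(1)] residue_eq[of "int i" n "int j - c"]
      add_mono[of 1 "int i" 0 "int n * (int j - c)"] unfolding dg_def mem_Collect_eq prod.case
    by linarith
qed

text \<open>Below \<open>k + 1\<close> there are only the end positions \<open>1, \<dots>, k\<close> of the empty rows.\<close>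
lemma u_num_first: "u_num n before (Suc k) 1 = k"
proof -
  have "end_pos n before i < int (Suc k) \<longleftrightarrow> i \<le> k" if "i \<in> {1..n}" for i
  proof (cases "i \<le> k")
    case True
    then show ?thesis using that entry_before(1)[of i] by (simp add: end_pos_def)
  next
    case False
    moreover have "int i \<le> end_pos n before i" by (simp add: end_pos_def)
    ultimately show ?thesis by linarith
  qed
  then have "{i \<in> {1..n}. end_pos n before i < int (Suc k)} = {1..k}" using k_less by auto
  then show ?thesis using u_num_eq[of 1 before "Suc k" n] entry_before(2) k_less by simp
qed

text \<open>Both sides count end positions below a bound, and \<open>cycle n k\<close> carries the end positions and the bound
  for \<open>after\<close> to those for \<open>before\<close>, preserving their order.\<close>
lemma u_num_shift_box:
  assumes "(i, j) \<in> dg n after" and ij': "shift_box n k (i, j) = (i', j')"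
  shows "u_num n before i' j' = u_num n after i j"
proof -
  let ?b = "int i + int n * (int j - 1)" and ?b' = "int i' + int n * (int j' - 1)"
  have b: "?b' = cycle n k ?b"
    using assms dg_after_row[OF assms(1)] by (intro box_pos_shift_box) (auto simp: dg_def)
  have iff: "end_pos n before (shift_row n k l) < ?b' \<longleftrightarrow> end_pos n after l < ?b" if "l \<in> {1..n}" for l
    unfolding b end_pos_shift_row[OF that]
    by (intro strict_mono_on_less[OF cycle_strict_mono[OF k_less]] end_pos_in_dom that
        box_pos_in_dom[OF assms(1)]) simp
  have "bij_betw (shift_row n k) {l \<in> {1..n}. end_pos n after l < ?b}
      {l \<in> {1..n}. end_pos n before l < ?b'}"
    using bij_betw_shift_row[OF k_less] iff by (rule bij_betw_Collect)
  moreover have "(i', j') \<in> dg n before" using assms dg_before by (metis imageI insertCI)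
  ultimately show ?thesis
    using assms bij_betw_same_card by (fastforce simp: u_num_eq dg_def)
qed

text \<open>Both sides list the boxes of \<open>before\<close> strictly by position, and a finite set of integers has only
  one such listing.\<close>
lemma boxes_before: "boxes n before = (Suc k, 1) # map (shift_box n k) (boxes n after)"
proof -
  define pos where "pos = (\<lambda>(i, j). int i + int n * int j)"
  have pos_shift: "pos (shift_box n k b) = cycle n k (pos b)" if "b \<in> dg n after" for b
  proof -
    obtain i j i' j' where b: "b = (i, j)" "shift_box n k (i, j) = (i', j')" by fastforce
    then show ?thesis
      using box_pos_shift_box[of i j i' j' 0] that dg_after_row[of i j]
      by (auto simp: pos_def dg_def)
  qed
  have dom: "pos b \<in> cycle_dom n k" if "b \<in> dg n after" for b
    using that box_pos_in_dom[of "fst b" "snd b" 0] by (auto simp: pos_def split: prod.splits)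
  have sorted: "sorted_wrt (\<lambda>b c. pos b < pos c) (boxes n \<kappa>)" for \<kappa>
    using boxes_correct(3)[of n \<kappa>]
    by (rule sorted_wrt_mono_rel[rotated]) (auto simp: pos_def simp flip: of_nat_add of_nat_mult)
  have first: "pos (Suc k, 1) < cycle n k (pos b)" if b: "b \<in> dg n after" for b
  proof -
    obtain i j where ij: "b = (i, j)" by fastforce
    have "k < i" "1 \<le> j" "i \<le> n" using b dg_after_row by (auto simp: ij dg_def)
    then have "int n * 1 \<le> int n * int j" by (intro mult_left_mono) auto
    then have "pos (Suc k, 1) \<le> pos b" using \<open>k < i\<close> by (auto simp: pos_def ij)
    moreover have "pos b < cycle n k (pos b)"
      using \<open>k < i\<close> \<open>i \<le> n\<close> residue_eq[of "int i" n "int j"] by (simp add: pos_def ij cycle_def)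
    ultimately show ?thesis by simp
  qed
  let ?L = "(Suc k, 1) # map (shift_box n k) (boxes n after)"
  have "sorted_wrt (\<lambda>b c. pos (shift_box n k b) < pos (shift_box n k c)) (boxes n after)"
    using sorted[of after]
    by (rule sorted_wrt_mono_rel[rotated])
       (auto simp: boxes_correct(1) pos_shift intro!: strict_mono_onD[OF cycle_strict_mono[OF k_less] dom dom])
  then have "sorted_wrt (<) (map pos ?L)"
    using first by (auto simp: sorted_wrt_map boxes_correct(1) pos_shift)
  moreover have "sorted_wrt (<) (map pos (boxes n before))"
    using sorted by (simp add: sorted_wrt_map)
  moreover have sets: "set (boxes n before) = set ?L"
    by (simp add: boxes_correct(1) dg_before)
  ultimately have "map pos (boxes n before) = map pos ?L"
    by (intro strict_sorted_equal) auto
  moreover have "inj_on pos (dg n before)"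
    using sorted[of before] unfolding boxes_correct(1)[symmetric, of n before]
    by (simp add: strict_sorted_iff distinct_map flip: sorted_wrt_map)
  ultimately show ?thesis
    using sets by (metis inj_on_map_eq_map boxes_correct(1) Un_absorb)
qed

end

section \<open>The greedy word\<close>

text \<open>Each recursion step removes one box, so the number of boxes serves as the induction measure.\<close>
lemma greedy_induct [consumes 1, case_names zero step]:
  assumes "length \<mu> = n"
    and "P (replicate n 0)"
    and "\<And>k m \<nu>. n = Suc (k + length \<nu>) \<Longrightarrow> P (replicate k 0 @ \<nu> @ [m]) \<Longrightarrow>
      P (replicate k 0 @ Suc m # \<nu>)"
  shows "P \<mu>"
  using assms(1)
proof (induction \<mu> rule: measure_induct_rule[where f = sum_list])
  case (less \<mu>)
  show ?case
  proof (cases "\<forall>x\<in>set \<mu>. x = 0")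
    case True
    then show ?thesis using assms(2) less.prems by (metis replicate_length_same)
  next
    case False
    then obtain xs x \<nu> where \<mu>: "\<mu> = xs @ x # \<nu>" "x \<noteq> 0" "\<forall>y\<in>set xs. y = 0"
      using split_list_first_prop[of \<mu> "\<lambda>x. x \<noteq> 0"] by auto
    have "xs = replicate (length xs) 0" using \<mu>(3) by (metis replicate_length_same)
    moreover obtain m where "x = Suc m" using \<mu>(2) not0_implies_Suc by blast
    ultimately have eq: "\<mu> = replicate (length xs) 0 @ Suc m # \<nu>" using \<mu>(1) by simp
    have "P (replicate (length xs) 0 @ \<nu> @ [m])"
      using less.prems by (intro less.IH) (auto simp: eq)
    then show ?thesis
      using assms(3)[of "length xs" \<nu> m] less.prems unfolding eq by simp
  qed
qed

lemma box_greedy_eq_boxes: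
  assumes "length \<mu> = n"
  shows "box_greedy \<mu> = concat (map (\<lambda>(i, j). s_pi_word (u_num n \<mu> i j)) (boxes n \<mu>))"
  using assms
proof (induction \<mu> rule: greedy_induct)
  case zero
  have "dg n (replicate n 0) = {}" by (auto simp: dg_def entry_def)
  then have "boxes n (replicate n 0) = []" using boxes_correct(1) by (metis set_empty)
  then show ?case by (simp add: box_greedy_zero)
next
  case (step k m \<nu>)
  interpret greedy_step n k m \<nu> using step by unfold_locales
  have "map (\<lambda>(i, j). s_pi_word (u_num n before i j)) (map (shift_box n k) (boxes n after)) =
      map (\<lambda>(i, j). s_pi_word (u_num n after i j)) (boxes n after)"
    using u_num_shift_box by (auto simp: boxes_correct(1) split: prod.splits)
  then show ?case
    using box_greedy_step[of "Suc k" "Suc m" \<nu>] step.IH u_num_first by (simp add: boxes_before del: map_map)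
qed

lemma increasing_rep_box_greedy:
  assumes "length \<mu> = n"
  shows "increasing_rep n \<mu> (word_val n (box_greedy \<mu>))"
  using assms
proof (induction \<mu> rule: greedy_induct)
  case zero
  have "end_pos n (replicate n 0) ` {1..n} = int ` {1..n}"
    by (intro image_cong) (auto simp: end_pos_def entry_def)
  then show ?case
    by (simp add: increasing_rep_def box_greedy_zero affine_perms_id[unfolded id_def]
        image_int_atLeastAtMost strict_mono_on_def)
next
  case (step k m \<nu>)
  interpret greedy_step n k m \<nu> using step by unfold_locales
  show ?case
    using increasing_rep_step[OF step.IH] box_greedy_step[of "Suc k" "Suc m" \<nu>]
    by (simp add: word_val_append word_val_s_pi_word k_less del: comp_apply)
qed

lemma s_pi_word_count: "length (filter (\<lambda>x. x \<noteq> Lpi) (s_pi_word k)) = k"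
  by (simp add: s_pi_word_def filter_map o_def)

theorem proposition2p2:
  fixes n :: nat and \<mu> :: "nat list"
  assumes "0 < n" and "length \<mu> = n"
  shows "(reduced_word n (box_greedy \<mu>) (u_elt n \<mu>) \<and>
          box_greedy \<mu> = concat (map (\<lambda>(i, j). s_pi_word (u_num n \<mu> i j)) (boxes n \<mu>))) \<and>
         (coroot_of n ` Inv n (u_elt n \<mu>) = (\<Union>(i, j) \<in> dg n \<mu>. R_set n \<mu> i j) \<and>
          len n (u_elt n \<mu>) = (\<Sum>(i, j) \<in> dg n \<mu>. u_num n \<mu> i j))"
proof -
  let ?u = "u_elt n \<mu>" and ?v = "v_elt n \<mu>"
  let ?D = "SIGMA (i, j):dg n \<mu>. {1..u_num n \<mu> i j}"
  define P where
    "P = (\<lambda>((i, j :: nat), r). (?v (int i), int r + int n * (int (entry \<mu> i) - int j + 1)))"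
  note word = box_greedy_eq_boxes[OF assms(2)]
  have val: "word_val n (box_greedy \<mu>) = ?u"
    using u_elt_eq[OF assms increasing_rep_box_greedy[OF assms(2)]] by simp
  have u: "increasing_rep n \<mu> ?u"
    using increasing_rep_box_greedy[OF assms(2)] unfolding val .
  have bij: "bij_betw P ?D (Inv n ?u)"
    unfolding P_def by (rule Inv_increasing_rep[OF assms(1) u v_elt_spec[OF assms u]])
  have "len n ?u = card ?D" using bij_betw_same_card[OF bij] by (simp add: len_def)
  also have "\<dots> = (\<Sum>(i, j) \<in> dg n \<mu>. u_num n \<mu> i j)"
    by (subst card_SigmaI) (auto simp: finite_dg intro!: sum.cong)
  finally have len: "len n ?u = (\<Sum>(i, j) \<in> dg n \<mu>. u_num n \<mu> i j)" .
  have "coroot_of n ` Inv n ?u = (\<lambda>x. coroot_of n (P x)) ` ?D"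
    unfolding bij_betw_imp_surj_on[OF bij, symmetric] by (rule image_image)
  also have "\<dots> = (\<lambda>((i, j), r). affine_coroot (?v (int i)) (int r) (int (entry \<mu> i) - int j + 1)) ` ?D"
  proof (intro image_cong refl, clarify)
    fix i j r assume "(i, j) \<in> dg n \<mu>" "r \<in> {1..u_num n \<mu> i j}"
    then have "1 \<le> int r" "int r \<le> int n" using u_num_less[of i j n \<mu>] by auto
    then show "coroot_of n (P ((i, j), r)) =
        affine_coroot (?v (int i)) (int r) (int (entry \<mu> i) - int j + 1)"
      by (simp add: P_def coroot_of_def residue_eq quot_eq)
  qed
  also have "\<dots> = (\<Union>(i, j) \<in> dg n \<mu>. R_set n \<mu> i j)"
  proof -
    have "R_set n \<mu> i j = (\<lambda>r. affine_coroot (?v (int i)) (int r) (int (entry \<mu> i) - int j + 1))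
        ` {1..u_num n \<mu> i j}" for i j
      unfolding R_set_def by auto
    then show ?thesis
      by (simp add: Sigma_def image_UN image_image UNION_singleton_eq_range case_prod_unfold)
  qed
  finally have coroots: "coroot_of n ` Inv n ?u = (\<Union>(i, j) \<in> dg n \<mu>. R_set n \<mu> i j)" .
  have "set (box_greedy \<mu>) \<subseteq> letters n"
    unfolding word using s_pi_word_letters[OF u_num_less] by (fastforce simp: boxes_correct(1))
  moreover have "length (filter (\<lambda>x. x \<noteq> Lpi) (box_greedy \<mu>)) =
      sum_list (map (\<lambda>(i, j). u_num n \<mu> i j) (boxes n \<mu>))"
    unfolding word filter_concat length_concat map_map o_def
    by (intro arg_cong[where f = sum_list] map_cong) (auto simp: s_pi_word_count)
  moreover have "\<dots> = len n ?u"
    unfolding len boxes_correct(1)[symmetric]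
    by (rule sum_list_distinct_conv_sum_set[OF boxes_correct(2)])
  ultimately have "reduced_word n (box_greedy \<mu>) ?u"
    using val by (simp add: reduced_word_def)
  then show ?thesis using word coroots len by blast
qed

end
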